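(* Let $\mathfrak{K_V}=(A,B(x),\mathbb X(x);\sigma_1,\sigma_2,\gamma,\gamma_*(x);\mathcal H,\mathbb C^2;\mathrm I=(x_0,\infty))$ be a Sturm-Liouville vessel with transfer function $S(\lambda,x)$. For $\lambda=is^2$ define $$h(x,s)=\begin{bmatrix}1&0\end{bmatrix}S(\lambda,x)\begin{bmatrix}1\\ s\end{bmatrix},\qquad K_S(x,s)=\frac{\begin{bmatrix}1&\bar s\end{bmatrix}S^*(\lambda,x)\sigma_1S(\lambda,x)\begin{bmatrix}1\\ s\end{bmatrix}}{\lambda+\bar\lambda},$$ and write $h(x,s)=|h(x,s)|e^{i\Theta_h(x,s)}$ with $\Theta_h$ real. Then: 1. $\overline{h(x,-\bar s)}=\dfrac{h(x,s)}{\det S(\lambda,x_0)}$; 2. $|h(x,s)|^2=\dfrac{\partial}{\partial x}K_S(x,s)+i(s-\bar s)K_S(x,s)$; 3. $2\dfrac{\partial}{\partial x}\Theta_h(x,s)=-\dfrac{s+\bar s}{|h(x,s)|^2}\dfrac{\partial}{\partial x}K_S(x,s)$.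
   Context: Sturm-Liouville (SL) vessel parameters on $\mathcal E=\mathbb C^2$: $$\sigma_1=\begin{bmatrix}0&1\\1&0\end{bmatrix},\ \sigma_2=\begin{bmatrix}1&0\\0&0\end{bmatrix},\ \gamma=\begin{bmatrix}0&0\\0&i\end{bmatrix},\ \gamma_*(x)=\begin{bmatrix}-i(\beta'(x)-\beta^2(x))&-\beta(x)\\ \beta(x)&i\end{bmatrix},$$ where $\beta$ is a real valued differentiable function on an interval $\mathrm I$. An SL vessel on $\mathrm I$ is a collection $(A,B(x),\mathbb X(x);\sigma_1,\sigma_2,\gamma,\gamma_*(x);\mathcal H,\mathbb C^2;\mathrm I)$ with these parameters, where $\mathcal H$ is a Hilbert space, $A,\mathbb X(x):\mathcal H\to\mathcal H$ ($A$ possibly unbounded with domain $D(A)$) and $B(x):\mathbb C^2\to\mathcal H$ satisfy the regularity assumptions: there is a point $x_1\in\mathrm I$ with $B(x_1)\mathbb C^2\subseteq D(A^n)$ and $\|A^nB(x_1)\|\le(C\sqrt n)^n$ for all $n\ge1$ and some $C>0$; $\mathbb X(x)$ is self-adjoint and invertible for all $x\in\mathrm I$; and the vessel conditions $$0=\tfrac{d}{dx}(B(x)\sigma_1)+AB(x)\sigma_2+B(x)\gamma,\quad A\mathbb X(x)+\mathbb X(x)A^*+B(x)\sigma_1B^*(x)=0,\quad \tfrac{d}{dx}\mathbb X(x)=B(x)\sigma_2B^*(x),$$ $$\gamma_*(x)=\gamma+\sigma_2B^*(x)\mathbb X^{-1}(x)B(x)\sigma_1-\sigma_1B^*(x)\mathbb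 X^{-1}(x)B(x)\sigma_2.$$ The transfer function is $S(\lambda,x)=I-B^*(x)\mathbb X^{-1}(x)(\lambda I-A)^{-1}B(x)\sigma_1$. The formulas are understood for those $s$ for which the quantities in them are defined ($\lambda=is^2$ and, in item 1, $-\bar\lambda$ outside $\operatorname{spec}A$; $\lambda+\bar\lambda\ne0$ in items 2, 3; $h(x,s)\neq0$ in item 3). The determinant $\det S(\lambda,x)$ does not depend on $x$; $\det S(\lambda,x_0)$ denotes this common value. *)

theory Defs
  imports "HOL-Analysis.Analysis"
begin

text \<open>Complex Hilbert spaces. The inner product is antilinear in the first and linear in the second
  argument. The completeness and the norm topology come from the class \<^class>\<open>banach\<close>.\<close>

class complex_hilbert = banach +
  fixes scaleC :: "complex \<Rightarrow> 'a \<Rightarrow> 'a" (infixr "*\<^sub>C" 75)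
    and cinner :: "'a \<Rightarrow> 'a \<Rightarrow> complex"
  assumes scaleR_scaleC: "scaleR r x = complex_of_real r *\<^sub>C x"
    and scaleC_add_right: "a *\<^sub>C (x + y) = a *\<^sub>C x + a *\<^sub>C y"
    and scaleC_add_left: "(a + b) *\<^sub>C x = a *\<^sub>C x + b *\<^sub>C x"
    and scaleC_scaleC: "a *\<^sub>C b *\<^sub>C x = (a * b) *\<^sub>C x"
    and scaleC_one: "1 *\<^sub>C x = x"
    and cinner_commute: "cinner x y = cnj (cinner y x)"
    and cinner_add_right: "cinner x (y + z) = cinner x y + cinner x z"
    and cinner_scaleC_right: "cinner x (a *\<^sub>C y) = a * cinner x y"
    and cinner_self: "cinner x x = complex_of_real ((norm x)\<^sup>2)"

instantiation complex :: complex_hilbert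
begin

definition scaleC_complex :: "complex \<Rightarrow> complex \<Rightarrow> complex" where
  "scaleC_complex a z = a * z"

definition cinner_complex :: "complex \<Rightarrow> complex \<Rightarrow> complex" where
  "cinner_complex z w = cnj z * w"

instance
  by standard
    (simp_all add: scaleC_complex_def cinner_complex_def scaleR_conv_of_real algebra_simps
      complex_norm_square del: of_real_power)

end

instantiation vec :: (complex_hilbert, finite) complex_hilbert
begin

definition scaleC_vec :: "complex \<Rightarrow> 'a ^ 'b \<Rightarrow> 'a ^ 'b" where
  "scaleC_vec a v = (\<chi> i. a *\<^sub>C (v $ i))"

definition cinner_vec :: "'a ^ 'b \<Rightarrow> 'a ^ 'b \<Rightarrow> complex" where
  "cinner_vec v w = (\<Sum>i\<in>UNIV. cinner (v $ i) (w $ i))"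

instance
proof
  fix v w :: "'a ^ 'b"
  show "cinner v w = cnj (cinner w v)"
    unfolding cinner_vec_def cnj_sum by (intro sum.cong refl cinner_commute)
  show "cinner v v = complex_of_real ((norm v)\<^sup>2)"
    by (simp add: cinner_vec_def cinner_self norm_vec_def L2_set_def sum_nonneg)
qed (simp_all add: scaleC_vec_def cinner_vec_def vec_eq_iff scaleR_scaleC scaleC_add_right
      scaleC_add_left scaleC_scaleC scaleC_one cinner_add_right cinner_scaleC_right
      sum.distrib sum_distrib_left)

end

definition bounded_clinear :: "('a::complex_hilbert \<Rightarrow> 'b::complex_hilbert) \<Rightarrow> bool" where
  "bounded_clinear T \<longleftrightarrow> bounded_linear T \<and> (\<forall>a u. T (a *\<^sub>C u) = a *\<^sub>C T u)"

definition selfadjoint_bounded :: "('a::complex_hilbert \<Rightarrow> 'a) \<Rightarrow> bool" where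
  "selfadjoint_bounded T \<longleftrightarrow> bounded_clinear T \<and> (\<forall>u v. cinner (T u) v = cinner u (T v))"

definition invertible_bounded :: "('a::complex_hilbert \<Rightarrow> 'b::complex_hilbert) \<Rightarrow> bool" where
  "invertible_bounded T \<longleftrightarrow> bounded_clinear T \<and> bij T \<and> bounded_clinear (inv T)"

text \<open>A possibly unbounded operator is a pair of a dense subspace \<open>D\<close> (its domain) and a function
  that is linear on \<open>D\<close>; the values of the function outside \<open>D\<close> are irrelevant.\<close>

definition densely_defined_operator ::
    "'a::complex_hilbert set \<Rightarrow> ('a \<Rightarrow> 'b::complex_hilbert) \<Rightarrow> bool" where
  "densely_defined_operator D T \<longleftrightarrow>
     0 \<in> D \<and> (\<forall>u\<in>D. \<forall>v\<in>D. u + v \<in> D \<and> T (u + v) = T u + T v) \<and>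
     (\<forall>a. \<forall>u\<in>D. a *\<^sub>C u \<in> D \<and> T (a *\<^sub>C u) = a *\<^sub>C T u) \<and> closure D = UNIV"

definition adj_dom :: "'a::complex_hilbert set \<Rightarrow> ('a \<Rightarrow> 'b::complex_hilbert) \<Rightarrow> 'b set" where
  "adj_dom D T = {v. \<exists>w. \<forall>u\<in>D. cinner (T u) v = cinner u w}"

definition adj_on ::
    "'a::complex_hilbert set \<Rightarrow> ('a \<Rightarrow> 'b::complex_hilbert) \<Rightarrow> 'b \<Rightarrow> 'a" where
  "adj_on D T v = (THE w. \<forall>u\<in>D. cinner (T u) v = cinner u w)"

abbreviation adj :: "('a::complex_hilbert \<Rightarrow> 'b::complex_hilbert) \<Rightarrow> 'b \<Rightarrow> 'a" where
  "adj T \<equiv> adj_on UNIV T"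

fun pow_dom :: "'a set \<Rightarrow> ('a \<Rightarrow> 'a) \<Rightarrow> nat \<Rightarrow> 'a set" where
  "pow_dom D T 0 = UNIV"
| "pow_dom D T (Suc n) = {u \<in> D. T u \<in> pow_dom D T n}"

definition resolvent ::
    "'a::complex_hilbert set \<Rightarrow> ('a \<Rightarrow> 'a) \<Rightarrow> complex \<Rightarrow> 'a \<Rightarrow> 'a" where
  "resolvent D T l = inv_into D (\<lambda>u. l *\<^sub>C u - T u)"

definition op_spectrum :: "'a::complex_hilbert set \<Rightarrow> ('a \<Rightarrow> 'a) \<Rightarrow> complex set" where
  "op_spectrum D T =
     - {l. bij_betw (\<lambda>u. l *\<^sub>C u - T u) D UNIV \<and> bounded_clinear (resolvent D T l)}"

definition sigma1 :: "complex ^ 2 ^ 2" where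
  "sigma1 = vector [vector [0, 1], vector [1, 0]]"

definition sigma2 :: "complex ^ 2 ^ 2" where
  "sigma2 = vector [vector [1, 0], vector [0, 0]]"

definition gamma :: "complex ^ 2 ^ 2" where
  "gamma = vector [vector [0, 0], vector [0, \<i>]]"

definition gamma_star :: "(real \<Rightarrow> real) \<Rightarrow> real set \<Rightarrow> real \<Rightarrow> complex ^ 2 ^ 2" where
  "gamma_star \<beta> I x =
     vector [vector [- \<i> * complex_of_real (vector_derivative \<beta> (at x within I) - (\<beta> x)\<^sup>2),
                     - complex_of_real (\<beta> x)],
             vector [complex_of_real (\<beta> x), \<i>]]"

text \<open>The Lyapunov equation is an identity of unbounded operators, \<open>A X(x)\<close> being equal to
  \<open>- X(x) A\<^sup>* - B(x) \<sigma>\<^sub>1 B\<^sup>*(x)\<close>, and so includes the equality of the two domains,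
  \<open>{v. X(x) v \<in> D(A)}\<close> and \<open>D(A\<^sup>*)\<close>. With only the inclusion of the second
  domain in the first, \<open>det S(\<lambda>,x)\<close> may depend on \<open>x\<close>.

  The derivatives of \<open>B(x) \<sigma>\<^sub>1\<close> and \<open>X(x)\<close> are taken pointwise on vectors. This is no loss:
  \<open>B(x)\<close> lives on a finite-dimensional space, and \<open>X'\<close> is then continuous in operator norm.\<close>

locale SL_vessel =
  fixes D :: "'h::complex_hilbert set"
    and A :: "'h \<Rightarrow> 'h"
    and B :: "real \<Rightarrow> complex ^ 2 \<Rightarrow> 'h"
    and X :: "real \<Rightarrow> 'h \<Rightarrow> 'h"
    and \<beta> :: "real \<Rightarrow> real"
    and I :: "real set"
  assumes interval: "is_interval I"
    and beta_differentiable: "\<And>x. x \<in> I \<Longrightarrow> \<beta> differentiable (at x within I)"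
    and A_operator: "densely_defined_operator D A"
    and B_bounded: "\<And>x. x \<in> I \<Longrightarrow> bounded_clinear (B x)"
    and regularity: "\<exists>x1\<in>I. \<exists>C>0. \<forall>n\<ge>1. range (B x1) \<subseteq> pow_dom D A n \<and>
          onorm (\<lambda>e. (A ^^ n) (B x1 e)) \<le> (C * sqrt (real n)) ^ n"
    and X_selfadjoint: "\<And>x. x \<in> I \<Longrightarrow> selfadjoint_bounded (X x)"
    and X_invertible: "\<And>x. x \<in> I \<Longrightarrow> invertible_bounded (X x)"
    and B_dom: "\<And>x e. x \<in> I \<Longrightarrow> B x (sigma2 *v e) \<in> D"
    and B_equation: "\<And>x e. x \<in> I \<Longrightarrow> ((\<lambda>y. B y (sigma1 *v e)) has_vector_derivative
          - A (B x (sigma2 *v e)) - B x (gamma *v e)) (at x within I)"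
    and Lyapunov_dom: "\<And>x. x \<in> I \<Longrightarrow> {v. X x v \<in> D} = adj_dom D A"
    and Lyapunov: "\<And>x v. x \<in> I \<Longrightarrow> v \<in> adj_dom D A \<Longrightarrow>
          A (X x v) + X x (adj_on D A v) + B x (sigma1 *v adj (B x) v) = 0"
    and X_equation: "\<And>x v. x \<in> I \<Longrightarrow> ((\<lambda>y. X y v) has_vector_derivative
          B x (sigma2 *v adj (B x) v)) (at x within I)"
    and linkage: "\<And>x. x \<in> I \<Longrightarrow> gamma_star \<beta> I x = gamma
          + sigma2 ** matrix (\<lambda>e. adj (B x) (inv (X x) (B x e))) ** sigma1
          - sigma1 ** matrix (\<lambda>e. adj (B x) (inv (X x) (B x e))) ** sigma2"

definition transfer ::
    "'h::complex_hilbert set \<Rightarrow> ('h \<Rightarrow> 'h) \<Rightarrow> (real \<Rightarrow> complex ^ 2 \<Rightarrow> 'h) \<Rightarrow>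
     (real \<Rightarrow> 'h \<Rightarrow> 'h) \<Rightarrow> complex \<Rightarrow> real \<Rightarrow> complex ^ 2 ^ 2" where
  "transfer D A B X l x =
     mat 1 - matrix (\<lambda>e. adj (B x) (inv (X x) (resolvent D A l (B x (sigma1 *v e)))))"

definition hermitian_conj :: "complex ^ 'n ^ 'm \<Rightarrow> complex ^ 'm ^ 'n" where
  "hermitian_conj M = map_matrix cnj (transpose M)"

text \<open>\<^const>\<open>scalar_product\<close> is bilinear, without conjugation, so that
  \<open>scalar_product u (M *v w)\<close> is the product of the row \<open>u\<close>, the matrix \<open>M\<close> and the column \<open>w\<close>.\<close>

definition h_fun ::
    "'h::complex_hilbert set \<Rightarrow> ('h \<Rightarrow> 'h) \<Rightarrow> (real \<Rightarrow> complex ^ 2 \<Rightarrow> 'h) \<Rightarrow>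
     (real \<Rightarrow> 'h \<Rightarrow> 'h) \<Rightarrow> real \<Rightarrow> complex \<Rightarrow> complex" where
  "h_fun D A B X x s =
     scalar_product (vector [1, 0]) (transfer D A B X (\<i> * s\<^sup>2) x *v vector [1, s])"

definition K_fun ::
    "'h::complex_hilbert set \<Rightarrow> ('h \<Rightarrow> 'h) \<Rightarrow> (real \<Rightarrow> complex ^ 2 \<Rightarrow> 'h) \<Rightarrow>
     (real \<Rightarrow> 'h \<Rightarrow> 'h) \<Rightarrow> real \<Rightarrow> complex \<Rightarrow> complex" where
  "K_fun D A B X x s =
     (let l = \<i> * s\<^sup>2; S = transfer D A B X l x in
      scalar_product (vector [1, cnj s])
        ((hermitian_conj S ** sigma1 ** S) *v vector [1, s]) / (l + cnj l))"

end

theory Submission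
  imports Defs
begin

text \<open>Put \<open>b\<^sub>1 = B e\<^sub>1\<close> and \<open>b\<^sub>2 = B e\<^sub>2\<close>. The first vessel condition reads
  \<open>b\<^sub>1' = - i b\<^sub>2\<close> and \<open>b\<^sub>2' = - A b\<^sub>1\<close>, where \<open>b\<^sub>1\<close> stays in the domain of \<open>A\<close>, and
  \<open>X' = b\<^sub>1 \<langle>b\<^sub>1, \<cdot>\<rangle>\<close>. A column of the transfer function is \<open>S e = e - B\<^sup>* w\<close> with the state
  \<open>w = X\<inverse> (\<lambda> - A)\<inverse> B \<sigma>\<^sub>1 e\<close>. Two computations carry the proof.

  First, the state can be differentiated (\<open>state_derivative\<close>), and the Lyapunov equation gives
  \<open>A\<^sup>* w\<close> (\<open>adjoint_state\<close>). Together they yield the differential equation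
  \<open>S' = \<sigma>\<^sub>1 (\<lambda> \<sigma>\<^sub>2 + \<gamma>\<^sub>*) S - S \<sigma>\<^sub>1 (\<lambda> \<sigma>\<^sub>2 + \<gamma>)\<close>, stated row by row in
  \<open>transfer_row1_derivative\<close> and \<open>transfer_row2_derivative\<close>. Both coefficient matrices have trace
  zero, so \<open>det S\<close> is constant. If \<open>\<lambda> = i s\<^sup>2\<close>, the vector \<open>(1, s)\<close> is an eigenvector of
  \<open>\<sigma>\<^sub>1 (\<lambda> \<sigma>\<^sub>2 + \<gamma>)\<close> for the eigenvalue \<open>i s\<close>; hence \<open>(h, g) = S (1, s)\<close> satisfies a linear
  system of size two. Since \<open>(\<lambda> + \<lambda>\<^sup>*) K = h\<^sup>* g + g\<^sup>* h\<close> (a star on a number is conjugation) and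
  \<open>\<lambda> + \<lambda>\<^sup>* = i (s - s\<^sup>*) (s + s\<^sup>*)\<close>, this system gives \<open>K'\<close>, which is the second claim. The same
  system gives the imaginary part of \<open>h' / h\<close>, which is the derivative of the phase; comparing it
  with \<open>K'\<close> gives the third claim.

  Second, the formula for \<open>A\<^sup>* w\<close> shows that \<open>S(l)\<^sup>* \<sigma>\<^sub>1 S(m)\<close> differs from \<open>\<sigma>\<^sub>1\<close> by a multiple
  of \<open>l\<^sup>* + m\<close> (\<open>transfer_symmetry\<close>). Hence \<open>S(- \<lambda>\<^sup>*)\<^sup>* \<sigma>\<^sub>1 S(\<lambda>) = \<sigma>\<^sub>1\<close>. This makes \<open>S(\<lambda>)\<close>
  invertible and, on inverting it by Cramer's rule, gives the first claim, because
  \<open>i (- s\<^sup>*)\<^sup>2 = - \<lambda>\<^sup>*\<close>.\<close>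

section \<open>Complex inner products and adjoints\<close>

lemma cinner_add_left: "cinner (x + y) z = cinner x z + cinner y (z::'a::complex_hilbert)"
  by (metis cinner_add_right cinner_commute complex_cnj_add)

lemma cinner_scaleC_left: "cinner (a *\<^sub>C x) y = cnj a * cinner x (y::'a::complex_hilbert)"
  by (metis cinner_commute cinner_scaleC_right complex_cnj_mult)

lemma cinner_zero_right [simp]: "cinner x (0::'a::complex_hilbert) = 0"
  using cinner_add_right[of x 0 0] by simp

lemma cinner_zero_left [simp]: "cinner (0::'a::complex_hilbert) x = 0"
  using cinner_add_left[of 0 0 x] by simp

lemma cinner_minus_right: "cinner x (- y) = - cinner x (y::'a::complex_hilbert)"
  using cinner_add_right[of x y "- y"] by (simp add: add_eq_0_iff)

lemma cinner_minus_left: "cinner (- x) y = - cinner x (y::'a::complex_hilbert)"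
  using cinner_add_left[of x "- x" y] by (simp add: add_eq_0_iff)

lemma cinner_diff_right: "cinner x (y - z) = cinner x y - cinner x (z::'a::complex_hilbert)"
  using cinner_add_right[of x y "- z"] by (simp add: cinner_minus_right)

lemma cinner_diff_left: "cinner (x - y) z = cinner x z - cinner y (z::'a::complex_hilbert)"
  using cinner_add_left[of x "- y" z] by (simp add: cinner_minus_left)

lemmas cinner_linear = cinner_add_left cinner_add_right cinner_diff_left cinner_diff_right
  cinner_minus_left cinner_minus_right cinner_scaleC_left cinner_scaleC_right

lemma norm_scaleC: "norm (a *\<^sub>C x) = cmod a * norm (x::'a::complex_hilbert)"
proof -
  have "complex_of_real ((norm (a *\<^sub>C x))\<^sup>2) = a * cnj a * complex_of_real ((norm x)\<^sup>2)"
    by (simp only: cinner_self[symmetric] cinner_linear) (simp add: mult_ac)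
  also have "\<dots> = complex_of_real ((cmod a * norm x)\<^sup>2)"
    by (simp add: complex_norm_square[symmetric] power_mult_distrib del: of_real_power)
  finally have "(norm (a *\<^sub>C x))\<^sup>2 = (cmod a * norm x)\<^sup>2"
    unfolding of_real_eq_iff .
  then show ?thesis by simp
qed

text \<open>For the real part, Cauchy-Schwarz is the triangle inequality squared. Rotating one argument
  by a unimodular scalar makes the inner product real and reduces the general case to this one.\<close>

lemma norm_cinner_le: "cmod (cinner x y) \<le> norm x * norm (y::'a::complex_hilbert)"
proof -
  have real_part: "Re (cinner x v) \<le> norm x * norm v" for v :: 'a
  proof -
    have "complex_of_real ((norm (x + v))\<^sup>2)
        = (norm x)\<^sup>2 + (norm v)\<^sup>2 + (cinner x v + cnj (cinner x v))"
      by (simp only: cinner_self[symmetric] cinner_linear cinner_commute[of x v, symmetric]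
          cinner_commute[of v x]) (simp add: cinner_self)
    then have "(norm (x + v))\<^sup>2 = (norm x)\<^sup>2 + (norm v)\<^sup>2 + 2 * Re (cinner x v)"
      by (simp add: complex_eq_iff)
    moreover have "(norm (x + v))\<^sup>2 \<le> (norm x + norm v)\<^sup>2"
      by (simp add: norm_triangle_ineq power_mono)
    ultimately show ?thesis by (simp add: power2_sum)
  qed
  show ?thesis
  proof (cases "cinner x y = 0")
    case False
    define a where "a = cnj (cinner x y) / cmod (cinner x y)"
    have "a * cinner x y = cmod (cinner x y)"
      using False complex_norm_square[of "cinner x y"]
      by (simp add: a_def power2_eq_square divide_eq_eq mult.commute)
    moreover have "cmod a = 1" using False by (simp add: a_def norm_divide)
    ultimately show ?thesis
      using real_part[of "a *\<^sub>C y"] by (simp add: cinner_scaleC_right norm_scaleC)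
  qed simp
qed

lemma bounded_bilinear_cinner:
  "bounded_bilinear (cinner :: 'a::complex_hilbert \<Rightarrow> 'a \<Rightarrow> complex)"
proof
  show "\<exists>K. \<forall>a b::'a. norm (cinner a b) \<le> norm a * norm b * K"
    using norm_cinner_le by (metis mult.right_neutral)
qed (simp_all add: cinner_linear scaleR_scaleC scaleC_complex_def)

lemmas has_vector_derivative_cinner =
  bounded_bilinear.has_vector_derivative[OF bounded_bilinear_cinner]

text \<open>On a dense domain the adjoint value is unique, because a vector orthogonal to a dense set is
  orthogonal to itself.\<close>

lemma adj_on_eqI:
  fixes T :: "'a::complex_hilbert \<Rightarrow> 'b::complex_hilbert"
  assumes dense: "closure D = UNIV"
    and w: "\<And>u. u \<in> D \<Longrightarrow> cinner (T u) v = cinner u w"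
  shows "adj_on D T v = w"
  unfolding adj_on_def
proof (rule the_equality)
  fix w' assume w': "\<forall>u\<in>D. cinner (T u) v = cinner u w'"
  have "closed {u. cinner u (w' - w) = 0}"
    by (intro closed_Collect_eq continuous_intros linear_continuous_on
        bounded_bilinear.bounded_linear_left[OF bounded_bilinear_cinner])
  moreover have "D \<subseteq> {u. cinner u (w' - w) = 0}"
    using w w' by (auto simp: cinner_linear)
  ultimately have "closure D \<subseteq> {u. cinner u (w' - w) = 0}" by (rule closure_minimal[rotated])
  then have "cinner (w' - w) (w' - w) = 0" by (auto simp: dense)
  then show "w' = w" by (simp add: cinner_self)
qed (use w in blast)

text \<open>Only the existence of an adjoint value is part of membership in \<^const>\<open>adj_dom\<close>; density turns
  the definite description into that value.\<close>

lemma cinner_adj_on: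
  fixes T :: "'a::complex_hilbert \<Rightarrow> 'b::complex_hilbert"
  assumes "closure D = UNIV" "v \<in> adj_dom D T" "u \<in> D"
  shows "cinner (T u) v = cinner u (adj_on D T v)"
proof -
  obtain w where w: "\<forall>u\<in>D. cinner (T u) v = cinner u w"
    using assms(2) by (auto simp: adj_dom_def)
  then have "adj_on D T v = w" by (intro adj_on_eqI assms) auto
  then show ?thesis using w assms(3) by simp
qed

section \<open>Coordinates on the two-dimensional space\<close>

lemma scaleC_vec_nth [simp]: "(a *\<^sub>C v) $ i = a * (v::complex^'n) $ i"
  by (simp add: scaleC_vec_def scaleC_complex_def)

lemma cinner_vec2: "cinner v (w::complex^2) = cnj (v $ 1) * w $ 1 + cnj (v $ 2) * w $ 2"
  by (simp add: cinner_vec_def sum_2 cinner_complex_def)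

lemma vec2_expand: "e = (e $ 1) *\<^sub>C axis 1 1 + (e $ 2) *\<^sub>C axis 2 (1::complex)" for e :: "complex^2"
  by (simp add: vec_eq_iff forall_2 axis_def)

lemma sigma1_mult: "sigma1 *v e = vector [e $ 2, e $ 1]"
  by (simp add: vec_eq_iff forall_2 matrix_vector_mult_def sum_2 sigma1_def)

lemma sigma2_mult: "sigma2 *v e = vector [e $ 1, 0]"
  by (simp add: vec_eq_iff forall_2 matrix_vector_mult_def sum_2 sigma2_def)

lemma gamma_mult: "gamma *v e = vector [0, \<i> * e $ 2]"
  by (simp add: vec_eq_iff forall_2 matrix_vector_mult_def sum_2 gamma_def)

lemma matrix_mult_vec_eq:
  fixes f :: "complex^2 \<Rightarrow> complex^2"
  assumes "\<And>u v. f (u + v) = f u + f v" "\<And>a u. f (a *\<^sub>C u) = a *\<^sub>C f u"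
  shows "matrix f *v e = f e"
proof -
  have "f e = (e $ 1) *\<^sub>C f (axis 1 1) + (e $ 2) *\<^sub>C f (axis 2 1)"
    by (subst vec2_expand[of e]) (simp add: assms del: scaleC_vec_nth)
  then show ?thesis
    by (simp add: vec_eq_iff matrix_vector_mult_def sum_2 matrix_def mult.commute)
qed

section \<open>Differentiating the solution of a linear equation\<close>

text \<open>Strong differentiability of \<open>X\<close> together with a lower bound on \<open>X y\<close> that is uniform in
  \<open>y\<close> suffices: the remainder of \<open>w\<close> is controlled by its image under \<open>X y\<close>, and that image only
  involves \<open>u\<close> and the values of \<open>X\<close> on the two fixed vectors \<open>w x\<close> and \<open>z\<close>.\<close>

lemma has_vector_derivative_linear_solution:
  fixes X :: "real \<Rightarrow> 'a::real_normed_vector \<Rightarrow> 'b::real_normed_vector"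
  assumes lin: "\<And>y. y \<in> I \<Longrightarrow> linear (X y)"
    and C: "C \<ge> 0"
    and lower: "\<forall>\<^sub>F y in at x within I. \<forall>v. norm v \<le> C * norm (X y v)"
    and solution: "\<And>y. y \<in> I \<Longrightarrow> X y (w y) = u y"
    and x: "x \<in> I"
    and u: "(u has_vector_derivative u') (at x within I)"
    and Xw: "((\<lambda>y. X y (w x)) has_vector_derivative X') (at x within I)"
    and Xz: "((\<lambda>y. X y z) has_vector_derivative Z') (at x within I)"
    and z: "X x z = u' - X'"
  shows "(w has_vector_derivative z) (at x within I)"
  unfolding has_vector_derivative_def has_derivative_iff_norm
proof
  define g where "g y = u y - X y (w x)" for y
  define r where "r y = norm (g y - g x - (y - x) *\<^sub>R X x z)" for y
  have "(g has_vector_derivative X x z) (at x within I)"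
    unfolding g_def z by (intro has_vector_derivative_diff u Xw)
  then have lim_g: "((\<lambda>y. r y / norm (y - x)) \<longlongrightarrow> 0) (at x within I)"
    by (simp add: has_vector_derivative_def has_derivative_iff_norm r_def)
  have "((\<lambda>y. X y z) \<longlongrightarrow> X x z) (at x within I)"
    using has_vector_derivative_continuous[OF Xz] by (simp add: continuous_within)
  then have lim_X: "((\<lambda>y. norm (X y z - X x z)) \<longlongrightarrow> 0) (at x within I)"
    by (simp add: tendsto_norm_zero_iff LIM_zero_iff)
  have lim: "((\<lambda>y. C * (r y / norm (y - x) + norm (X y z - X x z))) \<longlongrightarrow> 0) (at x within I)"
    using tendsto_mult_left[OF tendsto_add[OF lim_g lim_X], of C] by simp
  have near: "\<forall>\<^sub>F y in at x within I. y \<in> I \<and> y \<noteq> x"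
    by (simp add: eventually_at_filter)
  have "\<forall>\<^sub>F y in at x within I. norm (norm (w y - w x - (y - x) *\<^sub>R z) / norm (y - x))
      \<le> C * (r y / norm (y - x) + norm (X y z - X x z))"
    using lower near
  proof eventually_elim
    case (elim y)
    then have y: "y \<in> I" "norm (y - x) > 0" by auto
    have "X y (w y - w x - (y - x) *\<^sub>R z)
        = (g y - g x - (y - x) *\<^sub>R X x z) - (y - x) *\<^sub>R (X y z - X x z)"
      using solution[OF y(1)] solution[OF x] lin[OF y(1)]
      by (simp add: g_def linear_diff linear_scale scaleR_diff_right)
    then have "norm (X y (w y - w x - (y - x) *\<^sub>R z)) \<le> r y + norm (y - x) * norm (X y z - X x z)"
      unfolding r_def by (metis norm_scaleR norm_triangle_ineq4 real_norm_def)
    then have "norm (w y - w x - (y - x) *\<^sub>R z) \<le> C * (r y + norm (y - x) * norm (X y z - X x z))"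
      using elim(1) C by (meson mult_left_mono order_trans)
    also have "\<dots> = C * (r y / norm (y - x) + norm (X y z - X x z)) * norm (y - x)"
      using y(2) by (simp add: field_simps)
    finally show ?case using y(2) by (simp add: pos_divide_le_eq)
  qed
  then show "((\<lambda>y. norm (w y - w x - (y - x) *\<^sub>R z) / norm (y - x)) \<longlongrightarrow> 0) (at x within I)"
    using lim by (rule Lim_null_comparison)
qed (simp add: bounded_linear_scaleR_left)

section \<open>Differentiating a continuous phase\<close>

text \<open>A continuous phase differs near \<open>x\<close> from its value at \<open>x\<close> by less than \<open>\<pi>\<close>, so there it
  is that value plus the imaginary part of the principal logarithm of \<open>f / f x\<close>. This quotient
  takes the value 1 at \<open>x\<close>, away from the branch cut.\<close>

lemma phase_derivative:
  fixes f :: "real \<Rightarrow> complex" and \<Theta> :: "real \<Rightarrow> real"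
  assumes f: "(f has_vector_derivative f') (at x)" and nonzero: "f x \<noteq> 0"
    and polar: "\<forall>\<^sub>F y in nhds x. f y = complex_of_real (cmod (f y)) * exp (\<i> * complex_of_real (\<Theta> y))"
    and cont: "isCont \<Theta> x"
  shows "(\<Theta> has_vector_derivative Im (f' / f x)) (at x)"
proof -
  define q where "q y = f y / f x" for y
  have "(q has_vector_derivative f' / f x) (at x)"
    unfolding q_def by (intro has_vector_derivative_divide f)
  moreover have "(Ln has_field_derivative 1) (at (q x))"
    using has_field_derivative_Ln[of 1] nonzero by (simp add: q_def)
  ultimately have "(Ln \<circ> q has_vector_derivative f' / f x * 1) (at x)"
    by (rule field_vector_diff_chain_at)
  then have deriv: "((\<lambda>y. \<Theta> x + Im (Ln (q y))) has_vector_derivative 0 + Im (f' / f x)) (at x)"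
    by (intro has_vector_derivative_add has_vector_derivative_const
        bounded_linear.has_vector_derivative[OF bounded_linear_Im]) (simp add: o_def)
  have near: "\<forall>\<^sub>F y in nhds x. \<Theta> x + Im (Ln (q y)) = \<Theta> y"
  proof -
    have "\<forall>\<^sub>F y in nhds x. f y \<noteq> 0"
      using tendsto_imp_eventually_ne[OF isContD[OF has_vector_derivative_continuous[OF f]] nonzero]
        nonzero by (simp add: eventually_nhds_conv_at)
    moreover have "\<forall>\<^sub>F y in nhds x. dist (\<Theta> y) (\<Theta> x) < pi"
      using tendstoD[OF isContD[OF cont] pi_gt_zero] by (simp add: eventually_nhds_conv_at)
    ultimately show ?thesis using polar
    proof eventually_elim
      case (elim y)
      have "f x = complex_of_real (cmod (f x)) * exp (\<i> * complex_of_real (\<Theta> x))"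
        using eventually_nhds_x_imp_x[OF polar] .
      then have "q y = (complex_of_real (cmod (f y)) * exp (\<i> * complex_of_real (\<Theta> y)))
          / (complex_of_real (cmod (f x)) * exp (\<i> * complex_of_real (\<Theta> x)))"
        using elim(3) unfolding q_def by metis
      also have "\<dots> = complex_of_real (cmod (f y) / cmod (f x)) * exp (\<i> * complex_of_real (\<Theta> y - \<Theta> x))"
        by (simp add: exp_diff ring_distribs)
      also have "\<dots> = exp (complex_of_real (ln (cmod (f y) / cmod (f x)))
          + \<i> * complex_of_real (\<Theta> y - \<Theta> x))"
        using elim(1) nonzero by (simp add: exp_add exp_of_real)
      finally have "Ln (q y) = complex_of_real (ln (cmod (f y) / cmod (f x)))
          + \<i> * complex_of_real (\<Theta> y - \<Theta> x)"
        using elim(2) by (simp add: dist_real_def Ln_exp)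
      then show ?case by simp
    qed
  qed
  from near have "\<forall>\<^sub>F y in at x. \<Theta> x + Im (Ln (q y)) = \<Theta> y" "\<Theta> x + Im (Ln (q x)) = \<Theta> x"
    by (simp_all add: eventually_nhds_conv_at)
  then show ?thesis
    using deriv has_derivative_transform_eventually[of "\<lambda>y. \<Theta> x + Im (Ln (q y))" _ x UNIV \<Theta>]
    unfolding has_vector_derivative_def add_0 by blast
qed

section \<open>The state of a Sturm-Liouville vessel\<close>

lemma
  assumes "bounded_clinear T"
  shows bounded_clinear_linear: "linear T"
    and bounded_clinear_add: "T (u + v) = T u + T v"
    and bounded_clinear_diff: "T (u - v) = T u - T v"
    and bounded_clinear_minus: "T (- u) = - T u"
    and bounded_clinear_scaleC: "T (a *\<^sub>C u) = a *\<^sub>C T u"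
    and bounded_clinear_zero: "T 0 = 0"
proof -
  show l: "linear T"
    using assms unfolding bounded_clinear_def by (blast intro: bounded_linear.linear)
  show "T (u + v) = T u + T v" by (rule linear_add[OF l])
  show "T (u - v) = T u - T v" by (rule linear_diff[OF l])
  show "T (- u) = - T u" by (rule linear_neg[OF l])
  show "T 0 = 0" by (rule linear_0[OF l])
  show "T (a *\<^sub>C u) = a *\<^sub>C T u"
    using assms unfolding bounded_clinear_def by blast
qed

lemmas bounded_clinear_simps = bounded_clinear_add bounded_clinear_diff bounded_clinear_minus
  bounded_clinear_scaleC bounded_clinear_zero

lemma scaleC_zero_left [simp]: "0 *\<^sub>C u = (0::'a::complex_hilbert)"
  using scaleC_add_left[of 0 0 u] by simp

lemma scaleC_minus_left: "(- a) *\<^sub>C u = - (a *\<^sub>C (u::'a::complex_hilbert))"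
  using scaleC_add_left[of a "- a" u] by (simp add: add_eq_0_iff)

lemma scaleC_diff_left: "(a - b) *\<^sub>C u = a *\<^sub>C u - b *\<^sub>C (u::'a::complex_hilbert)"
  using scaleC_add_left[of a "- b" u] by (simp add: scaleC_minus_left)

context SL_vessel
begin

abbreviation S :: "complex \<Rightarrow> real \<Rightarrow> complex^2^2" where
  "S \<equiv> transfer D A B X"

abbreviation b1 :: "real \<Rightarrow> 'h" where "b1 x \<equiv> B x (axis 1 1)"

abbreviation b2 :: "real \<Rightarrow> 'h" where "b2 x \<equiv> B x (axis 2 1)"

definition input :: "complex \<Rightarrow> real \<Rightarrow> complex^2 \<Rightarrow> 'h" where
  "input l x e = resolvent D A l (B x (sigma1 *v e))"

definition state :: "complex \<Rightarrow> real \<Rightarrow> complex^2 \<Rightarrow> 'h" where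
  "state l x e = inv (X x) (input l x e)"

lemmas B_simps = bounded_clinear_simps[OF B_bounded]

lemma X_clinear: "x \<in> I \<Longrightarrow> bounded_clinear (X x)"
  using X_invertible by (simp add: invertible_bounded_def)

lemma inv_X_clinear: "x \<in> I \<Longrightarrow> bounded_clinear (inv (X x))"
  using X_invertible by (simp add: invertible_bounded_def)

lemma X_inv_X: "x \<in> I \<Longrightarrow> X x (inv (X x) v) = v"
  using X_invertible by (simp add: invertible_bounded_def bij_is_surj surj_f_inv_f)

lemma inv_X_X: "x \<in> I \<Longrightarrow> inv (X x) (X x v) = v"
  using X_invertible by (simp add: invertible_bounded_def bij_is_inj)

lemma cinner_X: "x \<in> I \<Longrightarrow> cinner (X x u) v = cinner u (X x v)"
  using X_selfadjoint by (simp add: selfadjoint_bounded_def)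

lemma cinner_inv_X: "x \<in> I \<Longrightarrow> cinner (inv (X x) u) v = cinner u (inv (X x) v)"
  using cinner_X[of x "inv (X x) u" "inv (X x) v"] by (simp add: X_inv_X)

lemma A_zero: "A 0 = 0"
proof -
  have "A (0 + 0) = A 0 + A 0"
    using A_operator unfolding densely_defined_operator_def by blast
  then show ?thesis by simp
qed

lemma domain_dense: "closure D = UNIV"
  using A_operator by (simp add: densely_defined_operator_def)

lemma B_expand: "x \<in> I \<Longrightarrow> B x e = (e $ 1) *\<^sub>C b1 x + (e $ 2) *\<^sub>C b2 x"
  by (subst vec2_expand[of e]) (simp add: B_simps del: scaleC_vec_nth)

lemma adj_B:
  assumes "x \<in> I"
  shows "adj (B x) v = vector [cinner (b1 x) v, cinner (b2 x) v]"
proof (rule adj_on_eqI)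
  fix u
  show "cinner (B x u) v = cinner u (vector [cinner (b1 x) v, cinner (b2 x) v])"
    by (simp add: B_expand[OF assms, of u] cinner_linear cinner_vec2)
qed simp

lemma cinner_B:
  assumes "x \<in> I"
  shows "cinner (B x e) v = cinner e (adj (B x) v)"
  by (simp add: adj_B[OF assms] B_expand[OF assms, of e] cinner_linear cinner_vec2)

lemma b1_derivative:
  assumes "x \<in> I"
  shows "(b1 has_vector_derivative - (\<i> *\<^sub>C b2 x)) (at x within I)"
proof -
  have "sigma1 *v axis 2 1 = (axis 1 1 :: complex^2)" "sigma2 *v axis 2 1 = (0 :: complex^2)"
    "gamma *v axis 2 1 = \<i> *\<^sub>C (axis 2 1 :: complex^2)"
    by (simp_all add: sigma1_mult sigma2_mult gamma_mult vec_eq_iff forall_2 axis_def)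
  then show ?thesis
    using B_equation[OF assms, of "axis 2 1"] assms by (simp add: B_simps A_zero)
qed

lemma b1_dom: "x \<in> I \<Longrightarrow> b1 x \<in> D"
proof -
  assume x: "x \<in> I"
  have "sigma2 *v axis 1 1 = (axis 1 1 :: complex^2)"
    by (simp add: sigma2_mult vec_eq_iff forall_2 axis_def)
  then show "b1 x \<in> D" using B_dom[OF x, of "axis 1 1"] by simp
qed

lemma b2_derivative:
  assumes "x \<in> I"
  shows "(b2 has_vector_derivative - A (b1 x)) (at x within I)"
proof -
  have "sigma1 *v axis 1 1 = (axis 2 1 :: complex^2)" "sigma2 *v axis 1 1 = (axis 1 1 :: complex^2)"
    "gamma *v axis 1 1 = (0 :: complex^2)"
    by (simp_all add: sigma1_mult sigma2_mult gamma_mult vec_eq_iff forall_2 axis_def)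
  then show ?thesis
    using B_equation[OF assms, of "axis 1 1"] assms by (simp add: B_simps)
qed

lemma X_derivative:
  assumes "x \<in> I"
  shows "((\<lambda>y. X y v) has_vector_derivative cinner (b1 x) v *\<^sub>C b1 x) (at x within I)"
  using X_equation[OF assms, of v] by (simp add: sigma2_mult adj_B B_expand[of x "vector [_, _]"] assms)

text \<open>Because \<open>X'\<close> is the rank-one operator \<open>b\<^sub>1 \<langle>b\<^sub>1, \<cdot>\<rangle>\<close>, whose norm is locally bounded by the
  continuity of \<open>b\<^sub>1\<close>, the mean value inequality upgrades the pointwise derivative to a Lipschitz
  bound in operator norm.\<close>

lemma X_lipschitz:
  assumes x: "x \<in> I"
  obtains d L where "d > 0" "L \<ge> 0"
    "\<forall>y\<in>I. dist y x < d \<longrightarrow> (\<forall>v. norm (X y v - X x v) \<le> L * norm v * norm (y - x))"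
proof -
  define K where "K = norm (b1 x) + 1"
  have "(b1 \<longlongrightarrow> b1 x) (at x within I)"
    using has_vector_derivative_continuous[OF b1_derivative[OF x]] by (simp add: continuous_within)
  then have "\<forall>\<^sub>F y in at x within I. norm (b1 y) < K"
    by (intro order_tendstoD(2)[OF tendsto_norm]) (auto simp: K_def)
  then obtain d where d: "d > 0" and K: "\<And>y. y \<in> I \<Longrightarrow> dist y x < d \<Longrightarrow> norm (b1 y) \<le> K"
    unfolding eventually_at by (metis K_def less_add_one less_imp_le)
  have "norm (X y v - X x v) \<le> K * K * norm v * norm (y - x)" if y: "y \<in> I" "dist y x < d" for y v
  proof (rule differentiable_bound)
    show "convex (I \<inter> ball x d)"
      using interval by (intro convex_Int is_interval_convex convex_ball)
    show "((\<lambda>y. X y v) has_derivative (\<lambda>t. t *\<^sub>R (cinner (b1 z) v *\<^sub>C b1 z)))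
        (at z within I \<inter> ball x d)" if "z \<in> I \<inter> ball x d" for z
      using has_vector_derivative_within_subset[OF X_derivative] that
      by (auto simp: has_vector_derivative_def)
    show "onorm (\<lambda>t. t *\<^sub>R (cinner (b1 z) v *\<^sub>C b1 z)) \<le> K * K * norm v" if "z \<in> I \<inter> ball x d" for z
    proof (rule onorm_le)
      fix t :: real
      have "norm (b1 z) \<le> K" using K that by (auto simp: dist_commute)
      then have "norm (b1 z) * norm v * norm (b1 z) \<le> K * norm v * K"
        by (intro mult_mono) (auto simp: K_def)
      then have "cmod (cinner (b1 z) v) * norm (b1 z) \<le> K * K * norm v"
        using mult_right_mono[OF norm_cinner_le[of "b1 z" v] norm_ge_zero[of "b1 z"]]
        by (simp add: mult_ac)
      then show "norm (t *\<^sub>R (cinner (b1 z) v *\<^sub>C b1 z)) \<le> K * K * norm v * norm t"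
        using mult_left_mono[OF _ abs_ge_zero[of t]] by (fastforce simp: norm_scaleC mult.commute)
    qed
  qed (use x y d in \<open>auto simp: dist_commute\<close>)
  moreover have "K * K \<ge> 0" by simp
  ultimately show ?thesis using that d by blast
qed

text \<open>An operator close in norm to the boundedly invertible \<open>X x\<close> inherits its lower bound, up to a
  factor of two.\<close>

lemma X_lower_bound:
  assumes x: "x \<in> I"
  obtains C where "C \<ge> 0" "\<forall>\<^sub>F y in at x within I. \<forall>v. norm v \<le> C * norm (X y v)"
proof -
  obtain N where N: "N > 0" "\<And>v. norm (inv (X x) v) \<le> norm v * N"
    using bounded_linear.pos_bounded[of "inv (X x)"] inv_X_clinear[OF x]
    by (auto simp: bounded_clinear_def)
  obtain d L where d: "d > 0" and L: "L \<ge> 0" and lip: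
    "\<forall>y\<in>I. dist y x < d \<longrightarrow> (\<forall>v. norm (X y v - X x v) \<le> L * norm v * norm (y - x))"
    using X_lipschitz[OF x] by blast
  \<comment> \<open>At this distance \<open>X y\<close> deviates from \<open>X x\<close> by at most half of the lower bound \<open>1 / N\<close>.\<close>
  define \<delta> where "\<delta> = min d (1 / (2 * N * (L + 1)))"
  have \<delta>: "\<delta> > 0" using d N L by (simp add: \<delta>_def)
  have "norm v \<le> 2 * N * norm (X y v)" if y: "y \<in> I" "dist y x < \<delta>" for y v
  proof -
    have "norm (y - x) * (2 * N * (L + 1)) \<le> 1"
      using y(2) N L by (simp add: \<delta>_def dist_norm pos_less_divide_eq)
    moreover have "norm (y - x) * (2 * N * (L + 1)) = 2 * N * L * norm (y - x) + 2 * N * norm (y - x)"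
      by (simp add: algebra_simps)
    moreover have "2 * N * norm (y - x) \<ge> 0" using N by simp
    ultimately have "2 * N * L * norm (y - x) \<le> 1" by linarith
    then have "2 * N * L * norm (y - x) * norm v \<le> norm v"
      using mult_right_mono[of "2 * N * L * norm (y - x)" 1 "norm v"] by simp
    moreover have "norm v \<le> norm (X x v) * N"
      using N(2)[of "X x v"] by (simp add: inv_X_X x)
    moreover have "norm (X x v - X y v) \<le> L * norm v * norm (y - x)"
      using lip y by (auto simp: \<delta>_def norm_minus_commute)
    then have "norm (X x v) * N \<le> (norm (X y v) + L * norm v * norm (y - x)) * N"
      using N norm_triangle_sub[of "X x v" "X y v"] by (intro mult_right_mono) auto
    ultimately show ?thesis by (simp add: algebra_simps)
  qed
  then have "\<forall>\<^sub>F y in at x within I. \<forall>v. norm v \<le> 2 * N * norm (X y v)"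
    unfolding eventually_at using \<delta> by blast
  then show ?thesis using that[of "2 * N"] N by simp
qed

lemma
  assumes "l \<notin> op_spectrum D A"
  shows resolvent_clinear: "bounded_clinear (resolvent D A l)"
    and resolvent_dom: "resolvent D A l v \<in> D"
    and resolvent_right: "l *\<^sub>C resolvent D A l v - A (resolvent D A l v) = v"
    and resolvent_left: "u \<in> D \<Longrightarrow> resolvent D A l (l *\<^sub>C u - A u) = u"
proof -
  have bij: "bij_betw (\<lambda>u. l *\<^sub>C u - A u) D UNIV" and R: "bounded_clinear (resolvent D A l)"
    using assms by (auto simp: op_spectrum_def)
  show "bounded_clinear (resolvent D A l)" by (rule R)
  have v: "v \<in> (\<lambda>u. l *\<^sub>C u - A u) ` D" using bij by (simp add: bij_betw_imp_surj_on)
  show "resolvent D A l v \<in> D" unfolding resolvent_def by (rule inv_into_into[OF v])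
  show "l *\<^sub>C resolvent D A l v - A (resolvent D A l v) = v"
    unfolding resolvent_def by (rule f_inv_into_f[OF v])
  show "resolvent D A l (l *\<^sub>C u - A u) = u" if "u \<in> D"
    unfolding resolvent_def using inv_into_f_f[OF bij_betw_imp_inj_on[OF bij] that] .
qed

text \<open>The matrix \<open>- \<sigma>\<^sub>1 (l \<sigma>\<^sub>2 + \<gamma>)\<close> applied to \<open>e\<close>.\<close>

definition drift :: "complex \<Rightarrow> complex^2 \<Rightarrow> complex^2" where
  "drift l e = vector [- \<i> * e $ 2, - l * e $ 1]"

lemma X_state: "x \<in> I \<Longrightarrow> X x (state l x e) = input l x e"
  by (simp add: state_def X_inv_X)

lemma
  assumes l: "l \<notin> op_spectrum D A" and x: "x \<in> I"
  shows state_add: "state l x (e + f) = state l x e + state l x f"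
    and state_scaleC: "state l x (a *\<^sub>C e) = a *\<^sub>C state l x e"
proof -
  have "sigma1 *v (a *\<^sub>C e) = a *\<^sub>C (sigma1 *v e)"
    by (simp add: sigma1_mult vec_eq_iff forall_2)
  then show "state l x (a *\<^sub>C e) = a *\<^sub>C state l x e"
    by (simp add: state_def input_def B_simps[OF x]
        bounded_clinear_simps[OF resolvent_clinear[OF l]] bounded_clinear_simps[OF inv_X_clinear[OF x]])
  show "state l x (e + f) = state l x e + state l x f"
    by (simp add: state_def input_def matrix_vector_right_distrib B_simps[OF x]
        bounded_clinear_simps[OF resolvent_clinear[OF l]] bounded_clinear_simps[OF inv_X_clinear[OF x]])
qed

lemma transfer_mult_vec:
  assumes l: "l \<notin> op_spectrum D A" and x: "x \<in> I"
  shows "S l x *v e = e - adj (B x) (state l x e)"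
proof -
  have "matrix (\<lambda>e. adj (B x) (state l x e)) *v e = adj (B x) (state l x e)"
    by (rule matrix_mult_vec_eq)
      (simp_all add: state_add[OF l x] state_scaleC[OF l x] adj_B[OF x] cinner_linear vec_eq_iff forall_2)
  then show ?thesis
    unfolding transfer_def state_def[symmetric] input_def[symmetric]
    by (simp add: matrix_vector_mult_diff_rdistrib)
qed

lemma
  assumes "l \<notin> op_spectrum D A" and "x \<in> I"
  shows transfer_row1: "(S l x *v e) $ 1 = e $ 1 - cinner (b1 x) (state l x e)"
    and transfer_row2: "(S l x *v e) $ 2 = e $ 2 - cinner (b2 x) (state l x e)"
  by (simp_all add: transfer_mult_vec[OF assms] adj_B[OF assms(2)])

text \<open>The resolvent turns the unbounded term of \<open>(B \<sigma>\<^sub>1 e)' = - A d - B \<gamma> e\<close>, where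
  \<open>d = B \<sigma>\<^sub>2 e\<close> lies in the domain of \<open>A\<close>, into the bounded expression
  \<open>- (l - A)\<inverse> A d = d - l (l - A)\<inverse> d\<close>. The remaining terms are again an input, for the vector
  \<^term>\<open>drift l e\<close>.\<close>

lemma input_derivative:
  assumes l: "l \<notin> op_spectrum D A" and x: "x \<in> I"
  shows "((\<lambda>y. input l y e) has_vector_derivative (e $ 1) *\<^sub>C b1 x + input l x (drift l e))
    (at x within I)"
proof -
  define d where "d = B x (sigma2 *v e)"
  have d: "d = (e $ 1) *\<^sub>C b1 x"
    by (simp add: d_def sigma2_mult B_expand[OF x, of "vector [_, _]"])
  have drift: "B x (sigma1 *v drift l e) = - (l *\<^sub>C d) - B x (gamma *v e)"
    by (simp add: d sigma1_mult gamma_mult drift_def B_expand[OF x, of "vector [_, _]"]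
        scaleC_minus_left scaleC_scaleC)
  note R = bounded_clinear_simps[OF resolvent_clinear[OF l]]
  have "resolvent D A l (l *\<^sub>C d - A d) = d"
    unfolding d_def by (intro resolvent_left l B_dom x)
  then have "resolvent D A l (- A d - B x (gamma *v e)) = d + input l x (drift l e)"
    by (simp add: R input_def drift algebra_simps)
  moreover have "((\<lambda>y. input l y e) has_vector_derivative resolvent D A l (- A d - B x (gamma *v e)))
      (at x within I)"
    unfolding input_def d_def using resolvent_clinear[OF l] B_equation[OF x]
    by (intro bounded_linear.has_vector_derivative[of "resolvent D A l"]) (auto simp: bounded_clinear_def)
  ultimately show ?thesis by (simp add: d)
qed

text \<open>The term \<open>X' w = \<langle>b\<^sub>1, w\<rangle> b\<^sub>1\<close>, which comes from differentiating the inverse of \<open>X\<close>, lowers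
  the coefficient of \<open>b\<^sub>1\<close> from \<open>e\<^sub>1\<close> to the first entry of \<open>S e\<close>.\<close>

lemma state_derivative:
  assumes l: "l \<notin> op_spectrum D A" and x: "x \<in> I"
  shows "((\<lambda>y. state l y e) has_vector_derivative
      (S l x *v e) $ 1 *\<^sub>C inv (X x) (b1 x) + state l x (drift l e)) (at x within I)"
proof -
  obtain C where C: "C \<ge> 0" "\<forall>\<^sub>F y in at x within I. \<forall>v. norm v \<le> C * norm (X y v)"
    by (rule X_lower_bound[OF x])
  show ?thesis
  proof (rule has_vector_derivative_linear_solution[where X = X and C = C and u = "\<lambda>y. input l y e"])
    show "X x ((S l x *v e) $ 1 *\<^sub>C inv (X x) (b1 x) + state l x (drift l e))
        = ((e $ 1) *\<^sub>C b1 x + input l x (drift l e)) - cinner (b1 x) (state l x e) *\<^sub>C b1 x"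
      by (simp add: bounded_clinear_simps[OF X_clinear[OF x]] X_inv_X[OF x] X_state[OF x]
          transfer_row1[OF l x] scaleC_diff_left algebra_simps)
  qed (use C x in \<open>auto intro: X_state X_derivative input_derivative[OF l]
      bounded_clinear_linear X_clinear\<close>)
qed

text \<open>Here the Lyapunov equation is used as an equality of domains: \<open>X\<close> maps the state to a value of
  the resolvent, which lies in the domain of \<open>A\<close>.\<close>

lemma state_dom: "l \<notin> op_spectrum D A \<Longrightarrow> x \<in> I \<Longrightarrow> state l x e \<in> adj_dom D A"
  using Lyapunov_dom[of x] by (auto simp: X_state input_def resolvent_dom)

text \<open>Solve the Lyapunov equation at the state \<open>w\<close> for \<open>A\<^sup>* w\<close>, with \<open>A X w = l X w - B \<sigma>\<^sub>1 e\<close> from the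
  resolvent. The two terms with \<open>B \<sigma>\<^sub>1\<close> combine to \<open>B \<sigma>\<^sub>1 S e\<close>.\<close>

lemma adjoint_state:
  assumes l: "l \<notin> op_spectrum D A" and x: "x \<in> I"
  shows "adj_on D A (state l x e)
    = inv (X x) (B x (sigma1 *v (S l x *v e))) - l *\<^sub>C state l x e"
proof -
  let ?a = "adj_on D A (state l x e)"
  have "l *\<^sub>C input l x e - A (input l x e) = B x (sigma1 *v e)"
    unfolding input_def by (rule resolvent_right[OF l])
  moreover have "A (input l x e) + X x ?a + B x (sigma1 *v adj (B x) (state l x e)) = 0"
    using Lyapunov[OF x state_dom[OF l x]] by (simp add: X_state[OF x])
  ultimately have "X x ?a = B x (sigma1 *v (S l x *v e)) - l *\<^sub>C input l x e"
    by (simp add: transfer_mult_vec[OF l x] matrix_vector_mult_diff_distrib B_simps[OF x]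
        algebra_simps eq_neg_iff_add_eq_0)
  then have "inv (X x) (X x ?a) = inv (X x) (B x (sigma1 *v (S l x *v e)) - l *\<^sub>C input l x e)"
    by simp
  then show ?thesis
    by (simp add: inv_X_X[OF x] bounded_clinear_simps[OF inv_X_clinear[OF x]] state_def)
qed

section \<open>The transfer function\<close>

text \<open>Evaluate \<open>\<langle>A u, w\<rangle>\<close> for \<open>u\<close> the input of \<open>e\<close> at \<open>l\<close> and \<open>w\<close> the state of \<open>f\<close> at \<open>m\<close> in two
  ways, by the resolvent equation for \<open>A u\<close> and by the formula for \<open>A\<^sup>* w\<close>. All
  other terms are values of \<open>B\<^sup>*\<close> on the two states, that is, \<open>e - S(l) e\<close> and \<open>f - S(m) f\<close>.\<close>

lemma transfer_symmetry:
  assumes l: "l \<notin> op_spectrum D A" and m: "m \<notin> op_spectrum D A" and x: "x \<in> I"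
  shows "cinner (S l x *v e) (sigma1 *v (S m x *v f))
    = cinner e (sigma1 *v f) - (cnj l + m) * cinner (input l x e) (state m x f)"
proof -
  let ?u = "input l x e" and ?w = "state m x f"
  have B_left: "cinner (B x (sigma1 *v e)) ?w = cinner (sigma1 *v e) (f - S m x *v f)"
    by (simp add: cinner_B[OF x] transfer_mult_vec[OF m x])
  have "cinner (state l x e) (B x v) = cinner (e - S l x *v e) v" for v
    by (simp add: cinner_commute[of _ "B x v"] cinner_commute[of _ v] cinner_B[OF x]
        transfer_mult_vec[OF l x])
  then have B_right: "cinner ?u (inv (X x) (B x v)) = cinner (e - S l x *v e) v" for v
    by (simp add: cinner_inv_X[OF x, symmetric] state_def)
  have "l *\<^sub>C ?u - A ?u = B x (sigma1 *v e)"
    unfolding input_def by (rule resolvent_right[OF l])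
  then have "cinner (A ?u) ?w = cnj l * cinner ?u ?w - cinner (B x (sigma1 *v e)) ?w"
    by (simp add: cinner_linear flip: \<open>l *\<^sub>C ?u - A ?u = B x (sigma1 *v e)\<close>)
  moreover have "cinner (A ?u) ?w = cinner ?u (adj_on D A ?w)"
    by (intro cinner_adj_on domain_dense state_dom m x) (simp add: input_def resolvent_dom[OF l])
  ultimately have "(cnj l + m) * cinner ?u ?w
      = cinner (e - S l x *v e) (sigma1 *v (S m x *v f)) + cinner (sigma1 *v e) (f - S m x *v f)"
    by (simp add: adjoint_state[OF m x] B_right B_left cinner_linear algebra_simps)
  moreover have "cinner (sigma1 *v e) v = cinner e (sigma1 *v v)" for v
    by (simp add: sigma1_mult cinner_vec2)
  ultimately show ?thesis by (simp add: cinner_linear)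
qed

text \<open>The two rows of \<open>(S e)' = \<sigma>\<^sub>1 (l \<sigma>\<^sub>2 + \<gamma>\<^sub>*) S e + S (drift e)\<close>, with the entries of \<open>\<gamma>\<^sub>*\<close>
  expressed through the Gram matrix of \<open>b\<^sub>1\<close> and \<open>b\<^sub>2\<close> with respect to the inverse of \<open>X\<close>, as in the
  linkage condition.\<close>

lemma transfer_row1_derivative:
  assumes l: "l \<notin> op_spectrum D A" and x: "x \<in> I"
  shows "((\<lambda>y. (S l y *v e) $ 1) has_vector_derivative
      \<i> * (S l x *v e) $ 2 - cinner (b1 x) (inv (X x) (b1 x)) * (S l x *v e) $ 1
      + (S l x *v drift l e) $ 1) (at x within I)"
proof -
  have "((\<lambda>y. e $ 1 - cinner (b1 y) (state l y e)) has_vector_derivative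
      0 - (cinner (b1 x) ((S l x *v e) $ 1 *\<^sub>C inv (X x) (b1 x) + state l x (drift l e))
        + cinner (- (\<i> *\<^sub>C b2 x)) (state l x e))) (at x within I)"
    by (intro has_vector_derivative_diff has_vector_derivative_const has_vector_derivative_cinner
        b1_derivative state_derivative l x)
  then have "((\<lambda>y. (S l y *v e) $ 1) has_vector_derivative
      0 - (cinner (b1 x) ((S l x *v e) $ 1 *\<^sub>C inv (X x) (b1 x) + state l x (drift l e))
        + cinner (- (\<i> *\<^sub>C b2 x)) (state l x e))) (at x within I)"
    by (rule has_vector_derivative_transform[OF x, rotated]) (simp add: transfer_row1[OF l])
  moreover have "(drift l e) $ 1 = - \<i> * e $ 2" by (simp add: drift_def)
  ultimately show ?thesis
    by (simp add: cinner_linear transfer_row1[OF l x] transfer_row2[OF l x] algebra_simps)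
qed

text \<open>The derivative of \<open>b\<^sub>2\<close> contributes \<open>\<langle>A b\<^sub>1, w\<rangle>\<close>, which involves the unbounded operator; moving it
  to the state makes it \<open>\<langle>b\<^sub>1, A\<^sup>* w\<rangle>\<close>, where \<open>adjoint_state\<close> applies.\<close>

lemma transfer_row2_derivative:
  assumes l: "l \<notin> op_spectrum D A" and x: "x \<in> I"
  shows "((\<lambda>y. (S l y *v e) $ 2) has_vector_derivative
      (l + cinner (b1 x) (inv (X x) (b2 x)) - cinner (b2 x) (inv (X x) (b1 x))) * (S l x *v e) $ 1
      + cinner (b1 x) (inv (X x) (b1 x)) * (S l x *v e) $ 2
      + (S l x *v drift l e) $ 2) (at x within I)"
proof -
  let ?w' = "(S l x *v e) $ 1 *\<^sub>C inv (X x) (b1 x) + state l x (drift l e)"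
  have "((\<lambda>y. e $ 2 - cinner (b2 y) (state l y e)) has_vector_derivative
      0 - (cinner (b2 x) ?w' + cinner (- A (b1 x)) (state l x e))) (at x within I)"
    by (intro has_vector_derivative_diff has_vector_derivative_const has_vector_derivative_cinner
        b2_derivative state_derivative l x)
  then have "((\<lambda>y. (S l y *v e) $ 2) has_vector_derivative
      0 - (cinner (b2 x) ?w' + cinner (- A (b1 x)) (state l x e))) (at x within I)"
    by (rule has_vector_derivative_transform[OF x, rotated]) (simp add: transfer_row2[OF l])
  moreover have "cinner (A (b1 x)) (state l x e) = cinner (b1 x) (adj_on D A (state l x e))"
    by (intro cinner_adj_on domain_dense state_dom b1_dom l x)
  moreover have "adj_on D A (state l x e) = (S l x *v e) $ 2 *\<^sub>C inv (X x) (b1 x)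
      + (S l x *v e) $ 1 *\<^sub>C inv (X x) (b2 x) - l *\<^sub>C state l x e"
    by (simp add: adjoint_state[OF l x] sigma1_mult B_expand[OF x, of "vector [_, _]"]
        bounded_clinear_simps[OF inv_X_clinear[OF x]])
  moreover have "(drift l e) $ 2 = - l * e $ 1" by (simp add: drift_def)
  ultimately show ?thesis
    by (simp add: cinner_linear transfer_row1[OF l x] transfer_row2[OF l x] algebra_simps)
qed

text \<open>Liouville's formula: the coefficient matrices acting on \<open>S\<close> from the left and from the right both
  have trace zero.\<close>

lemma det_transfer_const:
  assumes l: "l \<notin> op_spectrum D A" and "x \<in> I" "y \<in> I"
  shows "det (S l x) = det (S l y)"
proof -
  define c1 where "c1 x = S l x *v axis 1 1" for x
  define c2 where "c2 x = S l x *v axis 2 1" for x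
  have det: "det (S l x) = c1 x $ 1 * c2 x $ 2 - c2 x $ 1 * c1 x $ 2" for x
    by (simp add: det_2 c1_def c2_def matrix_vector_mult_def sum_2 axis_def)
  have "drift l (axis 1 1) = (- l) *s axis 2 1" "drift l (axis 2 1) = (- \<i>) *s axis 1 1"
    by (simp_all add: drift_def vec_eq_iff forall_2 axis_def)
  then have drift: "(S l x *v drift l (axis 1 1)) $ k = - l * (S l x *v axis 2 1) $ k"
      "(S l x *v drift l (axis 2 1)) $ k = - \<i> * (S l x *v axis 1 1) $ k" for x k
    by (simp_all only: vector_scalar_commute vector_smult_component)
  have "((\<lambda>y. det (S l y)) has_vector_derivative 0) (at x within I)" if x: "x \<in> I" for x
    using has_vector_derivative_diff[OF
        has_vector_derivative_mult[OF transfer_row1_derivative[OF l x, of "axis 1 1"]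
          transfer_row2_derivative[OF l x, of "axis 2 1"]]
        has_vector_derivative_mult[OF transfer_row1_derivative[OF l x, of "axis 2 1"]
          transfer_row2_derivative[OF l x, of "axis 1 1"]]]
    unfolding det c1_def c2_def drift by (simp add: algebra_simps)
  then obtain c where "\<And>x. x \<in> I \<Longrightarrow> det (S l x) = c"
    using has_vector_derivative_zero_constant[OF is_interval_convex[OF interval],
        of "\<lambda>x. det (S l x)"] by metis
  then show ?thesis using assms by simp
qed

text \<open>By the symmetry at \<open>- l\<^sup>*\<close> and \<open>l\<close>, a kernel vector \<open>e\<close> of \<open>S(l)\<close> would make \<open>\<sigma>\<^sub>1 e\<close> orthogonal to
  every vector.\<close>

lemma det_transfer_nonzero:
  assumes l: "l \<notin> op_spectrum D A" and l': "- cnj l \<notin> op_spectrum D A" and x: "x \<in> I"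
  shows "det (S l x) \<noteq> 0"
proof -
  have "e = 0" if "S l x *v e = 0" for e
  proof -
    have "cinner f (sigma1 *v e) = 0" for f
      using transfer_symmetry[OF l' l x, of f e] that by simp
    then have "cinner (sigma1 *v e) (sigma1 *v e) = 0" .
    then have "sigma1 *v e = 0" by (simp add: cinner_self)
    then show "e = 0" by (simp add: sigma1_mult vec_eq_iff forall_2)
  qed
  then have "invertible (S l x)"
    using matrix_left_invertible_ker[of "S l x"] by (auto simp: invertible_left_inverse)
  then show ?thesis by (simp add: invertible_det_nz)
qed

section \<open>The functions h and K\<close>

lemma h_fun_eq: "h_fun D A B X x s = (S (\<i> * s\<^sup>2) x *v vector [1, s]) $ 1"
  by (simp add: h_fun_def scalar_product_def sum_2)

lemma K_fun_eq: "K_fun D A B X x s =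
  (let c = S (\<i> * s\<^sup>2) x *v vector [1, s] in
    (cnj (c $ 1) * c $ 2 + cnj (c $ 2) * c $ 1) / (\<i> * s\<^sup>2 + cnj (\<i> * s\<^sup>2)))"
proof -
  have "scalar_product (vector [1, cnj s]) (hermitian_conj M *v v) = cinner (M *v vector [1, s]) v"
    for M :: "complex^2^2" and v
    by (simp add: scalar_product_def hermitian_conj_def map_matrix_def transpose_def sum_2 cinner_vec2
        matrix_vector_mult_def algebra_simps)
  then show ?thesis
    by (simp add: K_fun_def Let_def matrix_vector_mul_assoc[symmetric] sigma1_mult cinner_vec2)
qed

text \<open>This is where \<open>\<lambda> = i s\<^sup>2\<close> enters: \<open>(1, s)\<close> is an eigenvector of the drift, so the
  derivatives of \<open>S (1, s)\<close> involve no other column of \<open>S\<close>.\<close>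

lemma transfer_drift_eigenvector:
  "(M *v drift (\<i> * s\<^sup>2) (vector [1, s])) $ k = - \<i> * s * (M *v vector [1, s]) $ k"
proof -
  have "drift (\<i> * s\<^sup>2) (vector [1, s]) = (- \<i> * s) *s vector [1, s]"
    by (simp add: drift_def vec_eq_iff forall_2 power2_eq_square)
  then show ?thesis by (simp only: vector_scalar_commute vector_smult_component)
qed

lemma h_derivative:
  fixes s :: complex
  assumes l: "\<i> * s\<^sup>2 \<notin> op_spectrum D A" and x: "x \<in> I"
  shows "((\<lambda>y. h_fun D A B X y s) has_vector_derivative
      \<i> * (S (\<i> * s\<^sup>2) x *v vector [1, s]) $ 2
      - (cinner (b1 x) (inv (X x) (b1 x)) + \<i> * s) * h_fun D A B X x s) (at x within I)"
  using transfer_row1_derivative[OF l x, of "vector [1, s]"]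
  unfolding h_fun_eq transfer_drift_eigenvector by (simp add: algebra_simps)

text \<open>The Gram matrix of \<open>b\<^sub>1\<close> and \<open>b\<^sub>2\<close> is thus Hermitian: its diagonal is real, and the difference of
  its off-diagonal entries is imaginary.\<close>

lemma gram_commute: "x \<in> I \<Longrightarrow> cnj (cinner u (inv (X x) v)) = cinner v (inv (X x) u)"
  by (metis cinner_commute cinner_inv_X)

text \<open>Differentiate \<open>h\<^sup>* g + g\<^sup>* h = 2 Re (h\<^sup>* g)\<close>. Since the Gram matrix is Hermitian, its entries cancel
  between the conjugate halves; what remains is \<open>(l + l\<^sup>*) |h|\<^sup>2\<close> and a multiple of
  \<open>h\<^sup>* g + g\<^sup>* h\<close> itself.\<close>

lemma K_derivative:
  fixes s :: complex
  assumes l: "\<i> * s\<^sup>2 \<notin> op_spectrum D A" and x: "x \<in> I"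
    and nonzero: "\<i> * s\<^sup>2 + cnj (\<i> * s\<^sup>2) \<noteq> 0"
  shows "((\<lambda>y. K_fun D A B X y s) has_vector_derivative
      complex_of_real ((cmod (h_fun D A B X x s))\<^sup>2) - \<i> * (s - cnj s) * K_fun D A B X x s)
    (at x within I)"
proof -
  define l where "l = \<i> * s\<^sup>2"
  define h where "h y = (S l y *v vector [1, s]) $ 1" for y
  define g where "g y = (S l y *v vector [1, s]) $ 2" for y
  define M11 where "M11 = cinner (b1 x) (inv (X x) (b1 x))"
  define M12 where "M12 = cinner (b1 x) (inv (X x) (b2 x))"
  define M21 where "M21 = cinner (b2 x) (inv (X x) (b1 x))"
  have sym: "cnj M11 = M11" "cnj M12 = M21" "cnj M21 = M12"
    by (simp_all add: M11_def M12_def M21_def gram_commute x)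
  define h' where "h' = \<i> * g x - M11 * h x - \<i> * s * h x"
  define g' where "g' = (l + M12 - M21) * h x + M11 * g x - \<i> * s * g x"
  have h: "(h has_vector_derivative h') (at x within I)"
    using h_derivative[OF assms(1) x]
    unfolding h_fun_eq h_def g_def h'_def l_def M11_def by (simp add: algebra_simps)
  have g: "(g has_vector_derivative g') (at x within I)"
    using transfer_row2_derivative[OF assms(1) x, of "vector [1, s]"]
    unfolding transfer_drift_eigenvector h_def g_def g'_def l_def M11_def M12_def M21_def
    by (simp add: algebra_simps)
  have K: "K_fun D A B X y s = (cnj (h y) * g y + cnj (g y) * h y) / (l + cnj l)" for y
    by (simp add: K_fun_eq Let_def h_def g_def l_def)
  have "((\<lambda>y. K_fun D A B X y s) has_vector_derivative
      ((cnj (h x) * g' + cnj h' * g x) + (cnj (g x) * h' + cnj g' * h x)) / (l + cnj l)) (at x within I)"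
    unfolding K
    by (intro has_vector_derivative_divide has_vector_derivative_add has_vector_derivative_mult
        has_vector_derivative_cnj h g)
  moreover have "(cnj (h x) * g' + cnj h' * g x) + (cnj (g x) * h' + cnj g' * h x)
      = (l + cnj l) * (h x * cnj (h x)) - \<i> * (s - cnj s) * (cnj (h x) * g x + cnj (g x) * h x)"
    by (simp add: h'_def g'_def sym algebra_simps)
  moreover have "complex_of_real ((cmod (h x))\<^sup>2) = h x * cnj (h x)"
    by (rule complex_norm_square)
  ultimately show ?thesis
    using nonzero by (simp add: K h_fun_eq flip: h_def l_def) (simp add: diff_divide_distrib)
qed

text \<open>The term of \<open>h'\<close> with the real factor \<open>\<langle>b\<^sub>1, X\<inverse> b\<^sub>1\<rangle>\<close> drops out of the imaginary part, so
  \<open>2 |h|\<^sup>2 Im (h' / h) = (h\<^sup>* g + g\<^sup>* h) - (s + s\<^sup>*) |h|\<^sup>2\<close>. The first bracket is \<open>(\<lambda> + \<lambda>\<^sup>*) K\<close>, and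
  \<open>\<lambda> + \<lambda>\<^sup>*\<close> contains the factor \<open>s + s\<^sup>*\<close>.\<close>

lemma phase_speed:
  fixes s :: complex
  assumes x: "x \<in> I" and nonzero: "\<i> * s\<^sup>2 + cnj (\<i> * s\<^sup>2) \<noteq> 0"
    and h_nonzero: "h_fun D A B X x s \<noteq> 0"
  defines "h \<equiv> h_fun D A B X x s"
    and "h' \<equiv> \<i> * (S (\<i> * s\<^sup>2) x *v vector [1, s]) $ 2
      - (cinner (b1 x) (inv (X x) (b1 x)) + \<i> * s) * h_fun D A B X x s"
  shows "complex_of_real (2 * Im (h' / h)) = - ((s + cnj s) / complex_of_real ((cmod h)\<^sup>2))
    * (complex_of_real ((cmod h)\<^sup>2) - \<i> * (s - cnj s) * K_fun D A B X x s)"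
proof -
  define g where "g = (S (\<i> * s\<^sup>2) x *v vector [1, s]) $ 2"
  define M where "M = cinner (b1 x) (inv (X x) (b1 x))"
  have M: "cnj M = M" by (simp add: M_def gram_commute x)
  have h0: "h \<noteq> 0" using h_nonzero by (simp add: h_def)
  have h': "h' = \<i> * g - (M + \<i> * s) * h" by (simp add: h'_def g_def M_def h_def)
  have K: "(\<i> * (s - cnj s) * (s + cnj s)) * K_fun D A B X x s = cnj h * g + cnj g * h"
  proof -
    have "\<i> * (s - cnj s) * (s + cnj s) = \<i> * s\<^sup>2 + cnj (\<i> * s\<^sup>2)"
      by (simp add: power2_eq_square algebra_simps)
    then show ?thesis
      using nonzero unfolding K_fun_eq Let_def h_def h_fun_eq g_def by simp
  qed
  have norm: "complex_of_real ((cmod h)\<^sup>2) = h * cnj h" by (rule complex_norm_square)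
  have Im_eq: "complex_of_real (2 * Im z) = - \<i> * (z - cnj z)" for z
    by (simp add: complex_eq_iff)
  have "complex_of_real (2 * Im (h' / h)) = - \<i> * (h' / h - cnj (h' / h))"
    by (rule Im_eq)
  also have "\<dots> = - \<i> * (cnj h * h' - h * cnj h') / (h * cnj h)"
    using h0 by (simp add: field_simps)
  also have "- \<i> * (cnj h * h' - h * cnj h')
      = (\<i> * (s - cnj s) * (s + cnj s)) * K_fun D A B X x s - (s + cnj s) * (h * cnj h)"
    unfolding K by (simp add: h' M algebra_simps)
  finally show ?thesis
    using h0 unfolding norm by (simp add: field_simps)
qed

text \<open>Apply the symmetry to the vector that \<open>S(\<lambda>)\<close> maps to \<open>(0, det S)\<close>: the left side then contains
  only the first entry of \<open>S(- \<lambda>\<^sup>*) (1, - s\<^sup>*)\<close>, and the right side is the first entry of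
  \<open>S(\<lambda>) (1, s)\<close>.\<close>

lemma h_reflection:
  assumes l: "\<i> * s\<^sup>2 \<notin> op_spectrum D A" and l': "- cnj (\<i> * s\<^sup>2) \<notin> op_spectrum D A"
    and x: "x \<in> I"
  shows "cnj (h_fun D A B X x (- cnj s)) = h_fun D A B X x s / det (S (\<i> * s\<^sup>2) x)"
proof -
  let ?l = "\<i> * s\<^sup>2"
  \<comment> \<open>The second column of the adjugate of \<open>S(\<lambda>)\<close>.\<close>
  define e :: "complex^2" where "e = vector [- S ?l x $ 1 $ 2, S ?l x $ 1 $ 1]"
  define f :: "complex^2" where "f = vector [1, - cnj s]"
  have "S ?l x *v e = vector [0, det (S ?l x)]"
    by (simp add: e_def det_2 matrix_vector_mult_def sum_2 vec_eq_iff forall_2 algebra_simps)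
  moreover have "cinner (S (- cnj ?l) x *v f) (sigma1 *v (S ?l x *v e)) = cinner f (sigma1 *v e)"
    using transfer_symmetry[OF l' l x, of f e] by simp
  ultimately have "cnj ((S (- cnj ?l) x *v f) $ 1) * det (S ?l x) = S ?l x $ 1 $ 1 + s * S ?l x $ 1 $ 2"
    by (simp add: sigma1_mult cinner_vec2 e_def f_def)
  moreover have "\<i> * (- cnj s)\<^sup>2 = - cnj ?l" by simp
  ultimately have "cnj (h_fun D A B X x (- cnj s)) * det (S ?l x) = h_fun D A B X x s"
    unfolding h_fun_eq f_def by (simp add: matrix_vector_mult_def sum_2 mult.commute)
  then show ?thesis
    using det_transfer_nonzero[OF l l' x] by (simp add: field_simps)
qed

end

theorem theorem3p8:
  fixes D :: "'h::complex_hilbert set"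
    and A :: "'h \<Rightarrow> 'h"
    and B :: "real \<Rightarrow> complex ^ 2 \<Rightarrow> 'h"
    and X :: "real \<Rightarrow> 'h \<Rightarrow> 'h"
    and \<beta> :: "real \<Rightarrow> real"
    and x0 :: real
  assumes vessel: "SL_vessel D A B X \<beta> {x0<..}"
  defines "h \<equiv> h_fun D A B X"
    and "K \<equiv> K_fun D A B X"
    and "S \<equiv> transfer D A B X"
  shows "(\<forall>x>x0. \<forall>s. \<i> * s\<^sup>2 \<notin> op_spectrum D A \<and> - cnj (\<i> * s\<^sup>2) \<notin> op_spectrum D A \<longrightarrow>
            (\<forall>y>x0. cnj (h x (- cnj s)) = h x s / det (S (\<i> * s\<^sup>2) y)))
    \<and> (\<forall>x>x0. \<forall>s. \<i> * s\<^sup>2 \<notin> op_spectrum D A \<and> \<i> * s\<^sup>2 + cnj (\<i> * s\<^sup>2) \<noteq> 0 \<longrightarrow>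
            (\<lambda>y. K y s) differentiable (at x) \<and>
            complex_of_real ((cmod (h x s))\<^sup>2) =
              vector_derivative (\<lambda>y. K y s) (at x) + \<i> * (s - cnj s) * K x s)
    \<and> (\<forall>x>x0. \<forall>s. \<forall>\<Theta>::real \<Rightarrow> real.
          \<i> * s\<^sup>2 \<notin> op_spectrum D A \<and> \<i> * s\<^sup>2 + cnj (\<i> * s\<^sup>2) \<noteq> 0 \<and> h x s \<noteq> 0 \<and>
          (\<forall>y>x0. h y s = complex_of_real (cmod (h y s)) * exp (\<i> * complex_of_real (\<Theta> y))) \<and>
          isCont \<Theta> x \<longrightarrow>
            \<Theta> differentiable (at x) \<and>
            complex_of_real (2 * vector_derivative \<Theta> (at x)) =
              - ((s + cnj s) / complex_of_real ((cmod (h x s))\<^sup>2)) *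
                vector_derivative (\<lambda>y. K y s) (at x))"
proof -
  interpret SL_vessel D A B X \<beta> "{x0<..}" by (rule vessel)
  have at: "at x within {x0<..} = at x" if "x > x0" for x
    using that by (intro at_within_open) auto
  have 1: "cnj (h x (- cnj s)) = h x s / det (S (\<i> * s\<^sup>2) y)"
    if "x > x0" "y > x0" "\<i> * s\<^sup>2 \<notin> op_spectrum D A" "- cnj (\<i> * s\<^sup>2) \<notin> op_spectrum D A" for x y s
  proof -
    have "det (S (\<i> * s\<^sup>2) x) = det (S (\<i> * s\<^sup>2) y)"
      unfolding S_def using that by (intro det_transfer_const) auto
    moreover have "cnj (h x (- cnj s)) = h x s / det (S (\<i> * s\<^sup>2) x)"
      unfolding h_def S_def using that by (intro h_reflection) auto
    ultimately show ?thesis by metis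
  qed
  have K': "((\<lambda>y. K y s) has_vector_derivative
      complex_of_real ((cmod (h x s))\<^sup>2) - \<i> * (s - cnj s) * K x s) (at x)"
    if "x > x0" "\<i> * s\<^sup>2 \<notin> op_spectrum D A" "\<i> * s\<^sup>2 + cnj (\<i> * s\<^sup>2) \<noteq> 0" for x s
    unfolding K_def h_def at[OF that(1), symmetric] using that by (intro K_derivative) auto
  have 2: "(\<lambda>y. K y s) differentiable (at x) \<and>
      complex_of_real ((cmod (h x s))\<^sup>2)
        = vector_derivative (\<lambda>y. K y s) (at x) + \<i> * (s - cnj s) * K x s"
    if "x > x0" "\<i> * s\<^sup>2 \<notin> op_spectrum D A" "\<i> * s\<^sup>2 + cnj (\<i> * s\<^sup>2) \<noteq> 0" for x s
    unfolding vector_derivative_at[OF K'[OF that]]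
    using differentiableI_vector[OF K'[OF that]] by (simp only: diff_add_cancel simp_thms)
  have 3: "\<Theta> differentiable (at x) \<and> complex_of_real (2 * vector_derivative \<Theta> (at x)) =
      - ((s + cnj s) / complex_of_real ((cmod (h x s))\<^sup>2)) * vector_derivative (\<lambda>y. K y s) (at x)"
    if x: "x > x0" and l: "\<i> * s\<^sup>2 \<notin> op_spectrum D A" and nonzero: "\<i> * s\<^sup>2 + cnj (\<i> * s\<^sup>2) \<noteq> 0"
      and h0: "h x s \<noteq> 0" and cont: "isCont \<Theta> x"
      and polar: "\<forall>y>x0. h y s = complex_of_real (cmod (h y s)) * exp (\<i> * complex_of_real (\<Theta> y))"
    for x s and \<Theta> :: "real \<Rightarrow> real"
  proof -
    define h' where "h' = \<i> * (transfer D A B X (\<i> * s\<^sup>2) x *v vector [1, s]) $ 2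
      - (cinner (b1 x) (inv (X x) (b1 x)) + \<i> * s) * h x s"
    have \<Theta>: "(\<Theta> has_vector_derivative Im (h' / h x s)) (at x)"
    proof (rule phase_derivative)
      show "((\<lambda>y. h y s) has_vector_derivative h') (at x)"
        unfolding h'_def h_def at[OF x, symmetric] using x l by (intro h_derivative) auto
      have "\<forall>\<^sub>F y in nhds x. y > x0"
        using eventually_nhds_in_open[of "{x0<..}" x] x by simp
      then show "\<forall>\<^sub>F y in nhds x. h y s
          = complex_of_real (cmod (h y s)) * exp (\<i> * complex_of_real (\<Theta> y))"
        by (rule eventually_mono) (use polar in blast)
    qed (rule h0 cont)+
    have "complex_of_real (2 * Im (h' / h x s)) = - ((s + cnj s) / complex_of_real ((cmod (h x s))\<^sup>2))
        * (complex_of_real ((cmod (h x s))\<^sup>2) - \<i> * (s - cnj s) * K x s)"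
      unfolding h'_def h_def K_def
      using x nonzero h0 by (intro phase_speed) (auto simp: h_def)
    then show ?thesis
      unfolding vector_derivative_at[OF \<Theta>] vector_derivative_at[OF K'[OF x l nonzero]]
      using differentiableI_vector[OF \<Theta>] by blast
  qed
  show ?thesis
    using 1 2 3 by blast
qed

end
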